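(* Let $A$, the iterates $u_k$, the matrices $J_k$ and the errors $e_k$ be as in the context, and let $S_k=J_{k+1}^{1/2}-J_k^{1/2}$. Then there exist a positive number $\delta$ and a constant $c_3$ such that if $\|e_k\|<\delta$ then $$\|S_k\|\le c_3\sqrt{\|e_k\|}.$$
   Context: $A\in\mathbb{R}^{n\times n}$ is symmetric positive definite with eigenvalues $\lambda_1<\lambda_2<\dots<\lambda_n$ and unit eigenvector $v_1$ for $\lambda_1$. Vector norms are Euclidean and the norm of a symmetric matrix is the spectral norm. Newton iteration: $u_0$ is a unit vector; for $k\ge 0$, $\theta_k=u_k^\top A u_k$, $$J_k=(I-u_ku_k^\top)(A-\theta_k I)(I-u_ku_k^\top),$$ $s_k$ is an (exact or approximate) solution, lying in the subspace orthogonal to $u_k$, of the correction equation $J_ks_k=-(Au_k-\theta_ku_k)$, and $u_{k+1}=(u_k+s_k)/\|u_k+s_k\|$. Set $e_k=u_k-v_1$. Standing assumption: convergence holds, i.e. there is a constant $r<1$ with $\|e_{k+1}\|<r\|e_k\|$ for all $k\ge0$. For $u_k$ sufficiently close to $v_1$, $J_k$ is positive semidefinite (positive definite on $u_k^\perp$, with $J_ku_k=0$), and $J_k^{1/2}$ denotes its positive semidefinite square root. The numbers $\delta$ and $c_3$ do not depend on $k$. *)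

theory Defs
  imports "HOL-Analysis.Analysis"
begin

definition pos_semidef :: "real^'n^'n \<Rightarrow> bool" where
  "pos_semidef M \<longleftrightarrow> transpose M = M \<and> (\<forall>x. 0 \<le> x \<bullet> (M *v x))"

definition pos_def :: "real^'n^'n \<Rightarrow> bool" where
  "pos_def M \<longleftrightarrow> transpose M = M \<and> (\<forall>x. x \<noteq> 0 \<longrightarrow> 0 < x \<bullet> (M *v x))"

definition eigenvector :: "real^'n^'n \<Rightarrow> real^'n \<Rightarrow> real \<Rightarrow> bool" where
  "eigenvector M x l \<longleftrightarrow> x \<noteq> 0 \<and> M *v x = l *\<^sub>R x"

definition eigenvalue :: "real^'n^'n \<Rightarrow> real \<Rightarrow> bool" where
  "eigenvalue M l \<longleftrightarrow> (\<exists>x. eigenvector M x l)"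

definition spectral_norm :: "real^'n^'n \<Rightarrow> real" where
  "spectral_norm M = onorm (\<lambda>x. M *v x)"

text \<open>
  The positive semidefinite square root. It exists and is unique when \<open>M\<close> is positive semidefinite;
  for other \<open>M\<close> the value is unspecified.
\<close>
definition psd_sqrt :: "real^'n^'n \<Rightarrow> real^'n^'n" where
  "psd_sqrt M = (THE R. pos_semidef R \<and> R ** R = M)"

definition rayleigh :: "real^'n^'n \<Rightarrow> real^'n \<Rightarrow> real" where
  "rayleigh A u = u \<bullet> (A *v u)"

text \<open>\<open>I - u u\<^sup>T\<close>, the orthogonal projector onto the complement of \<open>u\<close> when \<open>u\<close> is a unit vector.\<close>
definition perp_proj :: "real^'n \<Rightarrow> real^'n^'n" where
  "perp_proj u = mat 1 - (columnvector u :: real^1^'n) ** (rowvector u :: real^'n^1)"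

definition newton_J :: "real^'n^'n \<Rightarrow> real^'n \<Rightarrow> real^'n^'n" where
  "newton_J A u = perp_proj u ** (A - rayleigh A u *\<^sub>R mat 1) ** perp_proj u"

text \<open>
  Exact or approximate solution of the correction equation: \<open>\<rho> k\<close> is the residual left by \<open>s k\<close>.
  It is \<open>0\<close> for an exact solve, and no bound is imposed on it here: the accuracy of the solves
  enters only through the convergence assumption on the iterates.
\<close>
definition newton_iteration ::
    "real^'n^'n \<Rightarrow> (nat \<Rightarrow> real^'n) \<Rightarrow> (nat \<Rightarrow> real^'n) \<Rightarrow> (nat \<Rightarrow> real^'n) \<Rightarrow> bool" where
  "newton_iteration A u s \<rho> \<longleftrightarrow>
     norm (u 0) = 1 \<and>
     (\<forall>k. s k \<bullet> u k = 0 \<and>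
          newton_J A (u k) *v s k = - (A *v u k - rayleigh A (u k) *\<^sub>R u k) + \<rho> k \<and>
          u (Suc k) = (u k + s k) /\<^sub>R norm (u k + s k))"

end

theory Submission
  imports Defs
begin

text \<open>
  For positive semidefinite \<open>R\<close>, \<open>Q\<close> one has \<open>\<parallel>R - Q\<parallel>\<^sup>2 \<le> \<parallel>R\<^sup>2 - Q\<^sup>2\<parallel>\<close>: if \<open>x\<close> is a unit eigenvector of
  \<open>R - Q\<close> for its largest eigenvalue \<open>\<mu> \<ge> 0\<close>, then
  \<open>x \<bullet> (R\<^sup>2 - Q\<^sup>2) x = \<mu> (x \<bullet> (R + Q) x) \<ge> \<mu> (x \<bullet> (R - Q) x) = \<mu>\<^sup>2\<close>.
  Hence the square root is Hoelder continuous with exponent 1/2, and \<open>u \<mapsto> J(u)\<close> is Lipschitz on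
  unit vectors. Since \<open>\<lambda>\<^sub>1\<close> is simple, \<open>A\<close> exceeds \<open>\<lambda>\<^sub>1\<close> by a positive gap on the complement of \<open>v\<^sub>1\<close>,
  which keeps \<open>J(u)\<close> positive semidefinite for \<open>u\<close> near \<open>v\<^sub>1\<close>.
\<close>

section \<open>Spectral theory of self-adjoint operators\<close>

text \<open>The quadratic form attains its maximum on the compact unit sphere of \<open>S\<close>,
  and the first-order condition at a maximiser is the eigenvector equation. Working inside an
  invariant subspace serves both the splitting off of eigenvectors one at a time and the
  minimisation of \<open>A\<close> on the complement of an eigenvector.\<close>

lemma selfadjoint_max_eigenvector:
  fixes T :: "'a::euclidean_space \<Rightarrow> 'a"
  assumes lin: "linear T" and sa: "\<And>x y. T x \<bullet> y = x \<bullet> T y"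
    and S: "subspace S" and inv: "\<And>x. x \<in> S \<Longrightarrow> T x \<in> S" and ne: "S \<noteq> {0}"
  obtains x \<mu> where "x \<in> S" "norm x = 1" "T x = \<mu> *\<^sub>R x" "\<And>z. z \<in> S \<Longrightarrow> z \<bullet> T z \<le> \<mu> * (z \<bullet> z)"
proof -
  have bl: "bounded_linear T" using lin by (rule linear_conv_bounded_linear[THEN iffD1])
  let ?K = "sphere 0 1 \<inter> S"
  have "compact ?K" by (intro compact_Int_closed closed_subspace S) simp
  moreover obtain y where y: "y \<in> S" "y \<noteq> 0" using ne subspace_0[OF S] by blast
  have "y /\<^sub>R norm y \<in> ?K" using y subspace_scale[OF S] by simp
  then have "?K \<noteq> {}" by blast
  moreover have "continuous_on ?K (\<lambda>x. x \<bullet> T x)"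
    by (intro continuous_intros linear_continuous_on bl)
  ultimately obtain x where x: "x \<in> ?K" and mx: "\<And>z. z \<in> ?K \<Longrightarrow> z \<bullet> T z \<le> x \<bullet> T x"
    using continuous_attains_sup by metis
  define \<mu> where "\<mu> = x \<bullet> T x"
  have le: "z \<bullet> T z \<le> \<mu> * (z \<bullet> z)" if z: "z \<in> S" for z
  proof (cases "z = 0")
    case False
    have "z /\<^sub>R norm z \<in> ?K" using z False subspace_scale[OF S] by simp
    from mx[OF this] have "(z \<bullet> T z) / (norm z)\<^sup>2 \<le> \<mu>"
      by (simp add: \<mu>_def linear_scale[OF lin] power2_eq_square divide_simps)
    then show ?thesis using False by (simp add: divide_le_eq dot_square_norm)
  qed simp
  \<comment> \<open>The residual of the eigenvector equation. It lies in \<open>S\<close>, so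
    \<open>x\<close> may be perturbed in its direction.\<close>
  define w where "w = \<mu> *\<^sub>R x - T x"
  have xS: "x \<in> S" "x \<bullet> x = 1" "norm x = 1" using x by (auto simp: dot_square_norm)
  have wS: "w \<in> S" unfolding w_def using xS inv subspace_scale[OF S] subspace_diff[OF S] by blast
  define q where "q = \<mu> * (w \<bullet> w) - w \<bullet> T w"
  have qge: "0 \<le> q" using le[OF wS] by (simp add: q_def)
  \<comment> \<open>The form \<open>\<mu> * (z \<bullet> z) - z \<bullet> T z\<close> is nonnegative
    on \<open>S\<close> and vanishes at \<open>x\<close>. Along \<open>x + t *\<^sub>R w\<close> it
    is this polynomial in \<open>t\<close>, whose linear coefficient
    \<open>2 * (w \<bullet> w)\<close> must therefore vanish.\<close>
  have quad: "0 \<le> 2 * t * (w \<bullet> w) + t\<^sup>2 * q" for t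
  proof -
    have "x + t *\<^sub>R w \<in> S" using xS wS subspace_scale[OF S] subspace_add[OF S] by blast
    from le[OF this]
    have "0 \<le> \<mu> * ((x + t *\<^sub>R w) \<bullet> (x + t *\<^sub>R w)) - (x + t *\<^sub>R w) \<bullet> T (x + t *\<^sub>R w)" by simp
    also have "\<dots> = (\<mu> * (x \<bullet> x) - x \<bullet> T x) + 2 * t * (\<mu> * (x \<bullet> w) - T x \<bullet> w) + t\<^sup>2 * q"
      unfolding q_def linear_add[OF lin] linear_scale[OF lin]
      using sa[of x w]
      by (simp add: inner_add_left inner_add_right inner_commute power2_eq_square algebra_simps)
    also have "\<mu> * (x \<bullet> w) - T x \<bullet> w = w \<bullet> w"
      by (simp add: w_def inner_diff_left inner_diff_right algebra_simps)
    finally show ?thesis using xS by (simp add: \<mu>_def)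
  qed
  have "w \<bullet> w = 0"
  proof (rule ccontr)
    assume ne0: "w \<bullet> w \<noteq> 0"
    \<comment> \<open>Nearly the minimiser of the polynomial: \<open>q + 1\<close> instead of
      \<open>q\<close> keeps the denominator positive when \<open>q = 0\<close>, and the value is
      still negative.\<close>
    define t where "t = - (w \<bullet> w) / (q + 1)"
    have "t * (q + 1) = - (w \<bullet> w)" using qge by (simp add: t_def)
    then have "2 * t * (w \<bullet> w) + t\<^sup>2 * q = - (t\<^sup>2 * (q + 2))"
      by (simp add: power2_eq_square algebra_simps) (algebra)
    moreover have "t \<noteq> 0" using ne0 qge by (simp add: t_def)
    ultimately show False using quad[of t] qge by (smt (verit) mult_pos_pos zero_less_power2)
  qed
  then have "T x = \<mu> *\<^sub>R x" by (simp add: w_def)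
  then show thesis using that[of x \<mu>] xS le by blast
qed

text \<open>Induction on the dimension: after a unit eigenvector \<open>x\<close> is split off,
  self-adjointness makes the orthogonal complement of \<open>x\<close> in \<open>S\<close> invariant
  again.\<close>

lemma selfadjoint_orthonormal_eigenbasis:
  fixes T :: "'a::euclidean_space \<Rightarrow> 'a"
  assumes lin: "linear T" and sa: "\<And>x y. T x \<bullet> y = x \<bullet> T y"
    and "subspace S" and "\<And>x. x \<in> S \<Longrightarrow> T x \<in> S"
  shows "\<exists>B. finite B \<and> pairwise orthogonal B \<and> span B = S \<and>
    (\<forall>b\<in>B. norm b = 1 \<and> (\<exists>\<mu>. T b = \<mu> *\<^sub>R b))"
  using assms(3,4)
proof (induction "dim S" arbitrary: S rule: less_induct)
  case less
  show ?case
  proof (cases "S = {0}")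
    case True
    then show ?thesis by (intro exI[of _ "{}"]) auto
  next
    case False
    obtain x \<mu> where x: "x \<in> S" "norm x = 1" "T x = \<mu> *\<^sub>R x"
      using selfadjoint_max_eigenvector[OF lin sa less.prems False] by metis
    define S' where "S' = S \<inter> {y. x \<bullet> y = 0}"
    have sub: "subspace S'" unfolding S'_def
      by (intro subspace_inter less.prems(1) subspace_hyperplane)
    have "x \<bullet> x = 1" using x by (simp add: dot_square_norm)
    then have "x \<notin> S'" by (simp add: S'_def)
    then have "S' \<subset> S" using x unfolding S'_def by blast
    then have dim: "dim S' < dim S"
      by (intro dim_psubset) (simp add: span_eq_iff[THEN iffD2] sub less.prems(1))
    have inv: "T y \<in> S'" if "y \<in> S'" for y
      using that less.prems(2) sa[of x y] x by (auto simp: S'_def)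
    obtain B where B: "finite B" "pairwise orthogonal B" "span B = S'"
      "\<forall>b\<in>B. norm b = 1 \<and> (\<exists>\<mu>. T b = \<mu> *\<^sub>R b)"
      using less.hyps[OF dim sub inv] by blast
    have BS: "B \<subseteq> S'" using B(3) span_superset by blast
    have "span (insert x B) = S"
    proof
      show "span (insert x B) \<subseteq> S"
        using BS x less.prems(1) by (intro span_minimal) (auto simp: S'_def)
      show "S \<subseteq> span (insert x B)"
      proof
        fix y assume y: "y \<in> S"
        have "y - (x \<bullet> y) *\<^sub>R x \<in> S'"
          using y x \<open>x \<bullet> x = 1\<close> subspace_scale[OF less.prems(1)] subspace_diff[OF less.prems(1)]
          by (auto simp: S'_def inner_diff_right)
        then show "y \<in> span (insert x B)" using B(3) span_insert[of x B] by blast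
      qed
    qed
    moreover have "pairwise orthogonal (insert x B)"
      using BS B(2) by (intro pairwise_orthogonal_insert) (auto simp: S'_def orthogonal_def)
    ultimately show ?thesis using B x by (intro exI[of _ "insert x B"]) auto
  qed
qed

section \<open>Symmetric matrices and existence of the square root\<close>

lemma symmetric_matrix_inner:
  fixes M :: "real^'n^'n"
  assumes "transpose M = M"
  shows "(M *v x) \<bullet> y = x \<bullet> (M *v y)"
  by (metis assms dot_lmul_matrix transpose_matrix_vector)

lemma symmetric_matrixI:
  fixes M :: "real^'n^'n"
  assumes "\<And>x y. (M *v x) \<bullet> y = x \<bullet> (M *v y)"
  shows "transpose M = M"
proof -
  have "transpose M *v x = M *v x" for x
    by (rule vector_eq_rdot[THEN iffD1], rule allI) (simp only: transpose_matrix_vector dot_lmul_matrix assms)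
  then show ?thesis by (simp add: matrix_eq)
qed

text \<open>Diagonalise in an orthonormal eigenbasis and replace each eigenvalue, nonnegative by
  assumption, by its square root.\<close>

lemma pos_semidef_sqrt_exists:
  fixes M :: "real^'n^'n"
  assumes M: "pos_semidef M"
  shows "\<exists>R. pos_semidef R \<and> R ** R = M"
proof -
  have sym: "transpose M = M" using M by (simp add: pos_semidef_def)
  obtain B where B: "finite B" "pairwise orthogonal B" "span B = (UNIV :: (real^'n) set)"
      "\<forall>b\<in>B. norm b = 1 \<and> (\<exists>\<mu>. M *v b = \<mu> *\<^sub>R b)"
    using selfadjoint_orthonormal_eigenbasis[of "\<lambda>x. M *v x" UNIV] symmetric_matrix_inner[OF sym]
    by (auto simp: matrix_vector_mul_linear)
  then obtain \<mu> where \<mu>: "\<And>b. b \<in> B \<Longrightarrow> M *v b = \<mu> b *\<^sub>R b" by metis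
  have bb: "b \<bullet> b = 1" if "b \<in> B" for b using that B by (simp add: dot_square_norm)
  have bc: "b \<bullet> c = (if b = c then 1 else 0)" if "b \<in> B" "c \<in> B" for b c
    using that B(2) bb by (auto simp: pairwise_def orthogonal_def)
  have \<mu>0: "0 \<le> \<mu> b" if b: "b \<in> B" for b
  proof -
    have "0 \<le> b \<bullet> (M *v b)" using M by (simp add: pos_semidef_def)
    then show ?thesis by (simp add: \<mu>[OF b] bb[OF b])
  qed
  have expand: "(\<Sum>b\<in>B. (x \<bullet> b) *\<^sub>R b) = x" for x
    by (rule orthonormal_basis_expand) (use B in auto)
  define f where "f x = (\<Sum>b\<in>B. (sqrt (\<mu> b) * (x \<bullet> b)) *\<^sub>R b)" for x
  have linf: "linear f" unfolding f_def
    by (rule linearI) (simp_all add: inner_add_left scaleR_add_left algebra_simps sum.distrib scaleR_sum_right)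
  define R where "R = matrix f"
  have R: "R *v x = f x" for x unfolding R_def using linf by (simp add: matrix_vector_mul)
  have fb: "f x \<bullet> c = sqrt (\<mu> c) * (x \<bullet> c)" if c: "c \<in> B" for x c
  proof -
    have "f x \<bullet> c = (\<Sum>b\<in>B. if b = c then sqrt (\<mu> b) * (x \<bullet> b) else 0)"
      unfolding f_def inner_sum_left by (rule sum.cong) (auto simp: bc c)
    also have "\<dots> = sqrt (\<mu> c) * (x \<bullet> c)" using c B(1) by (simp add: sum.delta)
    finally show ?thesis .
  qed
  have "f (f x) = M *v x" for x
  proof -
    have "f (f x) = (\<Sum>b\<in>B. (\<mu> b * (x \<bullet> b)) *\<^sub>R b)"
      unfolding f_def[of "f x"] using \<mu>0 by (intro sum.cong) (simp_all add: fb flip: mult.assoc)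
    also have "\<dots> = M *v (\<Sum>b\<in>B. (x \<bullet> b) *\<^sub>R b)"
      unfolding linear_sum[OF matrix_vector_mul_linear]
      by (intro sum.cong) (simp_all add: \<mu> matrix_vector_mult_scaleR mult.commute)
    finally show ?thesis by (simp only: expand)
  qed
  then have "R ** R = M" by (simp add: matrix_eq R flip: matrix_vector_mul_assoc)
  moreover have "pos_semidef R" unfolding pos_semidef_def
  proof
    show "transpose R = R"
      by (rule symmetric_matrixI)
        (simp add: R f_def inner_sum_left inner_sum_right inner_commute mult.commute mult.left_commute)
    have "x \<bullet> f x = (\<Sum>b\<in>B. sqrt (\<mu> b) * (x \<bullet> b)\<^sup>2)" for x
      by (simp add: f_def inner_sum_right power2_eq_square mult.assoc)
    then show "\<forall>x. 0 \<le> x \<bullet> (R *v x)" using \<mu>0 by (simp add: R sum_nonneg)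
  qed
  ultimately show ?thesis by blast
qed

section \<open>Spectral norm and Hoelder continuity of the square root\<close>

lemma norm_matrix_vector_le_spectral_norm: "norm (M *v x) \<le> spectral_norm M * norm x"
  unfolding spectral_norm_def by (rule onorm) (rule matrix_vector_mul_bounded_linear)

lemma spectral_norm_nonneg: "0 \<le> spectral_norm M"
  unfolding spectral_norm_def by (rule onorm_pos_le) (rule matrix_vector_mul_bounded_linear)

lemma spectral_norm_minus: "spectral_norm (- M) = spectral_norm M"
proof -
  have "(\<lambda>x. - M *v x) = (\<lambda>x. - (M *v x))"
    by (auto simp: matrix_vector_mult_def vec_eq_iff sum_negf)
  then show ?thesis by (simp add: spectral_norm_def onorm_neg)
qed

text \<open>Polarisation writes \<open>4 * (y \<bullet> (M *v x))\<close> as the difference of the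
  form at \<open>x + y\<close> and at \<open>x - y\<close>, and the parallelogram law bounds this by
  \<open>4 * K\<close> for unit vectors. Taking \<open>y\<close> in the direction of
  \<open>M *v x\<close> gives the norm.\<close>

lemma symmetric_spectral_norm_le:
  fixes M :: "real^'n^'n"
  assumes sym: "transpose M = M" and le: "\<And>x. \<bar>x \<bullet> (M *v x)\<bar> \<le> K * (x \<bullet> x)"
  shows "spectral_norm M \<le> K"
proof -
  have pol: "y \<bullet> (M *v x) \<le> K" if "norm x = 1" "norm y = 1" for x y
  proof -
    have "4 * (y \<bullet> (M *v x)) = (x + y) \<bullet> (M *v (x + y)) - (x - y) \<bullet> (M *v (x - y))"
      using symmetric_matrix_inner[OF sym, of x y]
      by (simp add: matrix_vector_right_distrib matrix_vector_mult_diff_distrib inner_add_left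
          inner_add_right inner_diff_left inner_diff_right inner_commute)
    also have "\<dots> \<le> K * ((x + y) \<bullet> (x + y)) + K * ((x - y) \<bullet> (x - y))"
      using le[of "x + y"] le[of "x - y"] by linarith
    also have "\<dots> = K * (2 * (x \<bullet> x) + 2 * (y \<bullet> y))"
      by (simp add: inner_add_left inner_add_right inner_diff_left inner_diff_right algebra_simps
          inner_commute)
    also have "\<dots> = 4 * K" using that by (simp add: dot_square_norm)
    finally show ?thesis by simp
  qed
  have unit: "norm (M *v x) \<le> K" if x: "norm x = 1" for x
  proof (cases "M *v x = 0")
    case True
    then show ?thesis using le[of x] x by (simp add: dot_square_norm)
  next
    case False
    then have "((M *v x) /\<^sub>R norm (M *v x)) \<bullet> (M *v x) = norm (M *v x)"
      by (simp add: dot_square_norm power2_eq_square)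
    then show ?thesis using pol[OF x, of "(M *v x) /\<^sub>R norm (M *v x)"] False by simp
  qed
  show ?thesis unfolding spectral_norm_def
  proof (rule onorm_le)
    fix x :: "real^'n"
    show "norm (M *v x) \<le> K * norm x"
    proof (cases "x = 0")
      case False
      then have "norm (M *v (x /\<^sub>R norm x)) \<le> K" by (intro unit) simp
      then show ?thesis using False by (simp add: matrix_vector_mult_scaleR divide_simps mult.commute)
    qed simp
  qed
qed

text \<open>This is the upper half of the bound on the form of \<open>R - Q\<close>; the lower half
  is the same statement with \<open>R\<close> and \<open>Q\<close> exchanged. It suffices to bound
  the largest eigenvalue of \<open>R - Q\<close>.\<close>

lemma pos_semidef_diff_quadratic_le:
  fixes R Q :: "real^'n^'n"
  assumes R: "pos_semidef R" and Q: "pos_semidef Q"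
  shows "x \<bullet> ((R - Q) *v x) \<le> sqrt (spectral_norm (R ** R - Q ** Q)) * (x \<bullet> x)"
proof -
  have sR: "\<And>x y. (R *v x) \<bullet> y = x \<bullet> (R *v y)" and sQ: "\<And>x y. (Q *v x) \<bullet> y = x \<bullet> (Q *v y)"
    using R Q symmetric_matrix_inner by (auto simp: pos_semidef_def)
  let ?D = "R ** R - Q ** Q"
  obtain e \<mu> where e: "norm e = 1" "(R - Q) *v e = \<mu> *\<^sub>R e"
      "\<And>z. z \<bullet> ((R - Q) *v z) \<le> \<mu> * (z \<bullet> z)"
  proof (rule selfadjoint_max_eigenvector[of "\<lambda>x. (R - Q) *v x" UNIV])
    show "(UNIV :: (real^'n) set) \<noteq> {0}" by (metis UNIV_I singletonD zero_neq_one)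
    show "linear (\<lambda>x. (R - Q) *v x)" by (rule matrix_vector_mul_linear)
    show "((R - Q) *v x) \<bullet> y = x \<bullet> ((R - Q) *v y)" for x y
      by (simp add: matrix_vector_mult_diff_rdistrib inner_diff_left inner_diff_right sR sQ)
  qed auto
  have ee: "e \<bullet> e = 1" using e by (simp add: dot_square_norm)
  have Re: "R *v e = Q *v e + \<mu> *\<^sub>R e" using e(2) by (simp add: matrix_vector_mult_diff_rdistrib algebra_simps)
  have "\<mu> \<le> sqrt (spectral_norm ?D)"
  proof (cases "\<mu> \<le> 0")
    case True
    then show ?thesis using spectral_norm_nonneg[of ?D] by (smt (verit) real_sqrt_ge_zero)
  next
    case False
    have "0 \<le> e \<bullet> (Q *v e)" using Q by (simp add: pos_semidef_def)
    \<comment> \<open>Substituting \<open>R *v e = Q *v e + \<mu> *\<^sub>R e\<close> turns the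
      right-hand side into the difference of the squared norms of \<open>R *v e\<close> and
      \<open>Q *v e\<close>, which is the form of \<open>R ** R - Q ** Q\<close> at
      \<open>e\<close>.\<close>
    then have "\<mu>\<^sup>2 \<le> \<mu> * (2 * (e \<bullet> (Q *v e)) + \<mu>)"
      using False by (simp add: power2_eq_square)
    also have "\<dots> = (R *v e) \<bullet> (R *v e) - (Q *v e) \<bullet> (Q *v e)"
      by (simp add: Re inner_add_left inner_add_right ee inner_commute algebra_simps)
    also have "\<dots> = e \<bullet> (?D *v e)"
      by (simp add: sR sQ matrix_vector_mult_diff_rdistrib inner_diff_right flip: matrix_vector_mul_assoc)
    also have "\<dots> \<le> norm e * norm (?D *v e)" by (rule norm_cauchy_schwarz)
    also have "\<dots> \<le> spectral_norm ?D"
      using norm_matrix_vector_le_spectral_norm[of ?D e] e by simp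
    finally show ?thesis by (rule real_le_rsqrt)
  qed
  then show ?thesis using e(3)[of x] by (meson inner_ge_zero mult_right_mono order_trans)
qed

lemma spectral_norm_pos_semidef_diff_le:
  fixes R Q :: "real^'n^'n"
  assumes R: "pos_semidef R" and Q: "pos_semidef Q"
  shows "spectral_norm (R - Q) \<le> sqrt (spectral_norm (R ** R - Q ** Q))"
proof (rule symmetric_spectral_norm_le)
  show "transpose (R - Q) = R - Q"
    using R Q by (auto simp: pos_semidef_def transpose_def vec_eq_iff)
  show "\<bar>x \<bullet> ((R - Q) *v x)\<bar> \<le> sqrt (spectral_norm (R ** R - Q ** Q)) * (x \<bullet> x)" for x
    using pos_semidef_diff_quadratic_le[OF R Q, of x] pos_semidef_diff_quadratic_le[OF Q R, of x]
      spectral_norm_minus[of "R ** R - Q ** Q"]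
    by (simp add: matrix_vector_mult_diff_rdistrib inner_diff_right abs_le_iff)
qed

text \<open>The description defining \<open>psd_sqrt\<close> needs a unique root. Uniqueness comes
  from the Hoelder bound: for two roots of the same matrix its right-hand side is
  \<open>sqrt 0\<close>.\<close>

lemma psd_sqrt_props:
  fixes M :: "real^'n^'n"
  assumes M: "pos_semidef M"
  shows "pos_semidef (psd_sqrt M)" "psd_sqrt M ** psd_sqrt M = M"
proof -
  have "R = Q" if "pos_semidef R \<and> R ** R = M" "pos_semidef Q \<and> Q ** Q = M" for R Q
  proof -
    have "spectral_norm (R - Q) \<le> 0"
      using spectral_norm_pos_semidef_diff_le[of R Q] that by (simp add: spectral_norm_def onorm_zero)
    then have "spectral_norm (R - Q) * norm x \<le> 0" for x by (simp add: mult_nonpos_nonneg)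
    then have "norm ((R - Q) *v x) \<le> 0" for x
      using norm_matrix_vector_le_spectral_norm[of "R - Q" x] order_trans by blast
    then show ?thesis by (simp add: matrix_eq matrix_vector_mult_diff_rdistrib)
  qed
  then have "\<exists>!R. pos_semidef R \<and> R ** R = M" using pos_semidef_sqrt_exists[OF M] by blast
  then have "pos_semidef (psd_sqrt M) \<and> psd_sqrt M ** psd_sqrt M = M"
    unfolding psd_sqrt_def by (rule theI')
  then show "pos_semidef (psd_sqrt M)" "psd_sqrt M ** psd_sqrt M = M" by auto
qed

lemma spectral_norm_psd_sqrt_diff_le:
  assumes "pos_semidef M" "pos_semidef N"
  shows "spectral_norm (psd_sqrt M - psd_sqrt N) \<le> sqrt (spectral_norm (M - N))"
  using spectral_norm_pos_semidef_diff_le[OF psd_sqrt_props(1)[OF assms(1)] psd_sqrt_props(1)[OF assms(2)]]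
  by (simp add: psd_sqrt_props(2) assms)

section \<open>Lipschitz dependence of the Newton matrix on the vector\<close>

lemma perp_proj_mult:
  fixes u :: "real^'n"
  shows "perp_proj u *v x = x - (u \<bullet> x) *\<^sub>R u"
proof -
  have "((columnvector u :: real^1^'n) ** (rowvector u :: real^'n^1)) *v x = (u \<bullet> x) *\<^sub>R u"
    by (simp add: vec_eq_iff matrix_vector_mult_def matrix_matrix_mult_def columnvector_def
        rowvector_def inner_vec_def sum_distrib_left sum_distrib_right mult_ac)
  then show ?thesis by (simp add: perp_proj_def matrix_vector_mult_diff_rdistrib)
qed

lemma newton_J_mult:
  "newton_J A u *v x = perp_proj u *v (A *v (perp_proj u *v x) - rayleigh A u *\<^sub>R (perp_proj u *v x))"
  by (simp add: newton_J_def matrix_vector_mult_diff_rdistrib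
      flip: matrix_vector_mul_assoc scaleR_matrix_vector_assoc)

text \<open>By symmetry of \<open>A\<close> the mixed terms cancel and the difference factors as
  \<open>(u - v) \<bullet> (A *v (u + v))\<close>; Cauchy-Schwarz bounds each half.\<close>

lemma rayleigh_diff_le:
  assumes A: "transpose A = A" and u: "norm u = 1" and v: "norm v = 1"
  shows "\<bar>rayleigh A u - rayleigh A v\<bar> \<le> 2 * spectral_norm A * norm (u - v)"
proof -
  have "rayleigh A u - rayleigh A v = (u - v) \<bullet> (A *v u) + (u - v) \<bullet> (A *v v)"
    using symmetric_matrix_inner[OF A, of u v]
    by (simp add: rayleigh_def inner_diff_left) (simp add: inner_commute)
  moreover have "\<bar>(u - v) \<bullet> (A *v x)\<bar> \<le> norm (u - v) * spectral_norm A" if "norm x = 1" for x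
    using Cauchy_Schwarz_ineq2[of "u - v" "A *v x"] norm_matrix_vector_le_spectral_norm[of A x] that
    by (smt (verit) mult_left_mono norm_ge_zero mult_cancel_left1)
  from this[OF u] this[OF v] have
    "\<bar>(u - v) \<bullet> (A *v u) + (u - v) \<bullet> (A *v v)\<bar> \<le> 2 * spectral_norm A * norm (u - v)"
    by (simp only: mult.commute[of "norm (u - v)"])
  ultimately show ?thesis by simp
qed

text \<open>The difference of the rank-one parts telescopes into two terms, each containing the
  factor \<open>v - u\<close> once.\<close>

lemma perp_proj_diff_le:
  assumes u: "norm u = 1" and v: "norm v = 1"
  shows "norm (perp_proj u *v x - perp_proj v *v x) \<le> 2 * norm (u - v) * norm x"
proof -
  have "perp_proj u *v x - perp_proj v *v x = ((v - u) \<bullet> x) *\<^sub>R v + (u \<bullet> x) *\<^sub>R (v - u)"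
    by (simp add: perp_proj_mult inner_diff_left algebra_simps)
  also have "norm \<dots> \<le> \<bar>(v - u) \<bullet> x\<bar> * norm v + \<bar>u \<bullet> x\<bar> * norm (v - u)"
    by (metis norm_scaleR norm_triangle_ineq)
  also have "\<dots> \<le> (norm (v - u) * norm x) * 1 + (norm u * norm x) * norm (v - u)"
    using v by (intro add_mono mult_mono Cauchy_Schwarz_ineq2) auto
  finally show ?thesis using u by (simp add: norm_minus_commute algebra_simps)
qed

lemma norm_perp_proj_le:
  assumes "norm u = 1"
  shows "norm (perp_proj u *v x) \<le> norm x"
proof -
  have "u \<bullet> u = 1" using assms by (simp add: dot_square_norm)
  then have "(norm (perp_proj u *v x))\<^sup>2 = (norm x)\<^sup>2 - (u \<bullet> x)\<^sup>2"
    unfolding perp_proj_mult power2_norm_eq_inner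
    by (simp add: inner_diff_left inner_diff_right inner_commute power2_eq_square algebra_simps)
  then have "(norm (perp_proj u *v x))\<^sup>2 \<le> (norm x)\<^sup>2" by simp
  then show ?thesis by (rule power2_le_imp_le) simp
qed

text \<open>The matrix is a product of projector, shifted \<open>A\<close> and projector;
  \<open>u\<close> is replaced by \<open>v\<close> in one factor at a time. The constant is 10 = 4 +
  2 + 4.\<close>

lemma newton_J_diff_le:
  fixes A :: "real^'n^'n"
  assumes A: "transpose A = A" and u: "norm u = 1" and v: "norm v = 1"
  shows "spectral_norm (newton_J A u - newton_J A v) \<le> 10 * spectral_norm A * norm (u - v)"
  unfolding spectral_norm_def[of "newton_J A u - newton_J A v"]
proof (rule onorm_le)
  fix x :: "real^'n"
  let ?P = "perp_proj u" and ?Q = "perp_proj v" and ?L = "spectral_norm A" and ?d = "norm (u - v)"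
  define B where "B w y = A *v y - rayleigh A w *\<^sub>R y" for w y
  have B_le: "norm (B w y) \<le> 2 * ?L * norm y" if w: "norm w = 1" for w y
  proof -
    have "\<bar>rayleigh A w\<bar> \<le> norm w * norm (A *v w)"
      unfolding rayleigh_def by (rule Cauchy_Schwarz_ineq2)
    then have "\<bar>rayleigh A w\<bar> \<le> ?L" using norm_matrix_vector_le_spectral_norm[of A w] w by simp
    then have "norm (rayleigh A w *\<^sub>R y) \<le> ?L * norm y" by (simp add: mult_right_mono)
    then show ?thesis unfolding B_def
      using norm_triangle_ineq4[of "A *v y" "rayleigh A w *\<^sub>R y"]
        norm_matrix_vector_le_spectral_norm[of A y] by simp
  qed
  have B_diff: "B w y - B w z = B w (y - z)" for w y z
    by (simp add: B_def matrix_vector_mult_diff_distrib algebra_simps)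
  have "(newton_J A u - newton_J A v) *v x = ?P *v B u (?P *v x) - ?Q *v B v (?Q *v x)"
    by (simp add: matrix_vector_mult_diff_rdistrib newton_J_mult B_def)
  \<comment> \<open>The three terms change the left projector, the shift and the right projector. A
    projector changes by at most \<open>2 * ?d\<close> and meets a middle factor of norm at most
    \<open>2 * ?L\<close>; the shift changes by at most \<open>2 * ?L * ?d\<close>. The remaining
    projectors have norm at most 1.\<close>
  also have "\<dots> = (?P *v B u (?P *v x) - ?Q *v B u (?P *v x))
      + ?Q *v (B u (?P *v x) - B v (?P *v x)) + ?Q *v B v (?P *v x - ?Q *v x)"
    by (simp add: matrix_vector_mult_diff_distrib flip: B_diff)
  also have "norm \<dots> \<le> 4 * ?L * ?d * norm x + 2 * ?L * ?d * norm x + 4 * ?L * ?d * norm x"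
  proof (intro norm_triangle_mono)
    have Px: "norm (?P *v x) \<le> norm x" by (rule norm_perp_proj_le[OF u])
    have L0: "0 \<le> ?L" by (rule spectral_norm_nonneg)
    have "norm (?P *v B u (?P *v x) - ?Q *v B u (?P *v x)) \<le> 2 * ?d * norm (B u (?P *v x))"
      by (rule perp_proj_diff_le[OF u v])
    also have "\<dots> \<le> 2 * ?d * (2 * ?L * norm (?P *v x))" by (intro mult_left_mono B_le u) auto
    also have "\<dots> \<le> 2 * ?d * (2 * ?L * norm x)" using L0 Px by (intro mult_left_mono) auto
    finally show "norm (?P *v B u (?P *v x) - ?Q *v B u (?P *v x)) \<le> 4 * ?L * ?d * norm x"
      by (simp add: algebra_simps)
    have "norm (?Q *v (B u (?P *v x) - B v (?P *v x))) \<le> norm (B u (?P *v x) - B v (?P *v x))"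
      by (rule norm_perp_proj_le[OF v])
    also have "\<dots> = norm ((rayleigh A v - rayleigh A u) *\<^sub>R (?P *v x))"
      by (simp add: B_def algebra_simps)
    also have "\<dots> \<le> (2 * ?L * ?d) * norm x"
      using rayleigh_diff_le[OF A u v] Px L0 by (simp add: abs_minus_commute mult_mono)
    finally show "norm (?Q *v (B u (?P *v x) - B v (?P *v x))) \<le> 2 * ?L * ?d * norm x" .
    have "norm (?Q *v B v (?P *v x - ?Q *v x)) \<le> norm (B v (?P *v x - ?Q *v x))"
      by (rule norm_perp_proj_le[OF v])
    also have "\<dots> \<le> 2 * ?L * norm (?P *v x - ?Q *v x)" by (rule B_le[OF v])
    also have "\<dots> \<le> 2 * ?L * (2 * ?d * norm x)"
      using L0 by (intro mult_left_mono perp_proj_diff_le u v) auto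
    finally show "norm (?Q *v B v (?P *v x - ?Q *v x)) \<le> 4 * ?L * ?d * norm x"
      by (simp add: algebra_simps)
  qed
  finally show "norm ((newton_J A u - newton_J A v) *v x) \<le> 10 * ?L * ?d * norm x"
    by (simp add: algebra_simps)
qed

section \<open>Spectral gap and positivity of the Newton matrix near the eigenvector\<close>

lemma orthogonal_eigenvectors:
  fixes A :: "real^'n^'n"
  assumes A: "transpose A = A" and "A *v x = a *\<^sub>R x" "A *v y = b *\<^sub>R y" "a \<noteq> b"
  shows "x \<bullet> y = 0"
  using symmetric_matrix_inner[OF A, of x y] \<open>a \<noteq> b\<close> by (simp add: assms(2,3))

text \<open>One eigenvector per eigenvalue already gives \<open>CARD('n)\<close> pairwise orthogonal
  vectors. A nonzero \<open>w\<close> would be orthogonal to all of them, making one independent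
  vector too many.\<close>

lemma distinct_eigenvalues_simple:
  fixes A :: "real^'n^'n"
  assumes A: "transpose A = A" and card: "card {l. eigenvalue A l} = CARD('n)"
    and v: "eigenvector A v l" and w: "A *v w = l *\<^sub>R w" and vw: "w \<bullet> v = 0"
  shows "w = 0"
proof (rule ccontr)
  assume w0: "w \<noteq> 0"
  define g where "g m = (SOME x. eigenvector A x m)" for m
  have g: "eigenvector A (g m) m" if "eigenvalue A m" for m
    using that unfolding eigenvalue_def g_def by (rule someI_ex)
  \<comment> \<open>The representative for \<open>l\<close> must be \<open>v\<close> itself:
    orthogonality to it is the assumption on \<open>w\<close>, whereas two eigenvectors for the same
    eigenvalue need not be orthogonal.\<close>
  define h where "h = g(l := v)"
  have h: "eigenvector A (h m) m" if "eigenvalue A m" for m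
    using that g v by (simp add: h_def)
  define E where "E = {m. eigenvalue A m}"
  have orth: "h a \<bullet> h b = 0" if "a \<in> E" "b \<in> E" "a \<noteq> b" for a b
    using orthogonal_eigenvectors[OF A] h that by (auto simp: E_def eigenvector_def)
  have horth: "w \<bullet> h a = 0" if "a \<in> E" for a
  proof (cases "a = l")
    case True
    then show ?thesis by (simp add: h_def vw)
  next
    case False
    then show ?thesis using orthogonal_eigenvectors[OF A w] h that by (auto simp: E_def eigenvector_def)
  qed
  have h0: "h a \<noteq> 0" if "a \<in> E" for a using h that by (auto simp: E_def eigenvector_def)
  have finE: "finite E" using card unfolding E_def by (metis card.infinite zero_less_card_finite less_irrefl)
  have inj: "inj_on h E" using orth h0 by (metis inj_onI inner_eq_zero_iff)
  have "w \<notin> h ` E" using horth w0 by force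
  then have "card (insert w (h ` E)) = CARD('n) + 1"
    using finE card card_image[OF inj] by (simp add: E_def)
  moreover have "pairwise orthogonal (insert w (h ` E))"
    using horth orth by (auto simp: pairwise_def orthogonal_def inner_commute)
  then have "independent (insert w (h ` E))"
    using w0 h0 by (intro pairwise_orthogonal_independent) auto
  then have "card (insert w (h ` E)) \<le> DIM(real^'n)" using independent_bound by blast
  ultimately show False by simp
qed

text \<open>The minimum of the form on the unit vectors orthogonal to \<open>v\<close> is an
  eigenvalue, hence at least \<open>l\<close>, and it differs from \<open>l\<close> because
  \<open>l\<close> is simple.\<close>

lemma eigenvalue_gap:
  fixes A :: "real^'n^'n"
  assumes A: "transpose A = A" and card: "card {l. eigenvalue A l} = CARD('n)"
    and v: "eigenvector A v l" and least: "\<And>m. eigenvalue A m \<Longrightarrow> l \<le> m"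
  obtains m where "l < m" "\<And>w. w \<bullet> v = 0 \<Longrightarrow> m * (w \<bullet> w) \<le> w \<bullet> (A *v w)"
proof (cases "{w. v \<bullet> w = 0} = {0}")
  case True
  \<comment> \<open>In dimension one the complement of \<open>v\<close> is trivial and carries no
    further eigenvalue, so any number above \<open>l\<close> serves as \<open>m\<close>.\<close>
  have "(l + 1) * (w \<bullet> w) \<le> w \<bullet> (A *v w)" if "w \<bullet> v = 0" for w
  proof -
    have "w \<in> {w. v \<bullet> w = 0}" using that by (simp add: inner_commute)
    then have "w = 0" unfolding True by simp
    then show ?thesis by simp
  qed
  then show thesis by (intro that[of "l + 1"]) auto
next
  case False
  \<comment> \<open>Negating \<open>A\<close> turns the maximum principle into a minimum principle;
    the gap value is then \<open>- \<mu>\<close>.\<close>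
  let ?T = "\<lambda>x. - (A *v x)"
  have Av: "A *v v = l *\<^sub>R v" using v by (simp add: eigenvector_def)
  have inv: "?T x \<in> {w. v \<bullet> w = 0}" if "x \<in> {w. v \<bullet> w = 0}" for x
    using that symmetric_matrix_inner[OF A, of v x] by (simp add: Av)
  have lin: "linear ?T" by (intro linear_compose_neg matrix_vector_mul_linear)
  have sa: "?T x \<bullet> y = x \<bullet> ?T y" for x y by (simp add: symmetric_matrix_inner[OF A])
  obtain e \<mu> where e: "e \<in> {w. v \<bullet> w = 0}" "norm e = 1" "?T e = \<mu> *\<^sub>R e"
      "\<And>z. z \<in> {w. v \<bullet> w = 0} \<Longrightarrow> z \<bullet> ?T z \<le> \<mu> * (z \<bullet> z)"
    using selfadjoint_max_eigenvector[OF lin sa subspace_hyperplane inv False] by blast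
  have Ae: "A *v e = (- \<mu>) *\<^sub>R e" using e(3) by (metis minus_minus scaleR_minus_left)
  have e0: "e \<noteq> 0" using e(2) by auto
  then have "eigenvalue A (- \<mu>)" using Ae by (auto simp: eigenvalue_def eigenvector_def)
  then have "l \<le> - \<mu>" by (rule least)
  moreover have "l \<noteq> - \<mu>"
    using distinct_eigenvalues_simple[OF A card v, of e] Ae e(1) e0 by (auto simp: inner_commute)
  ultimately have "l < - \<mu>" by simp
  then show thesis
  proof (rule that)
    fix w assume "w \<bullet> v = 0"
    then show "- \<mu> * (w \<bullet> w) \<le> w \<bullet> (A *v w)" using e(4)[of w] by (simp add: inner_commute[of w v])
  qed
qed

text \<open>It has to be shown that the form of \<open>A\<close> at the projected vector
  \<open>z\<close> is at least \<open>rayleigh A u * (z \<bullet> z)\<close>. Since \<open>z\<close>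
  is orthogonal to \<open>u\<close>, its component along the nearby \<open>v\<close> is small, so
  the form is close to at least \<open>m\<close>, while the Rayleigh quotient is close to
  \<open>l\<close>.\<close>

lemma newton_J_pos_semidef:
  fixes A :: "real^'n^'n"
  assumes A: "transpose A = A" and v: "norm v = 1" "A *v v = l *\<^sub>R v"
    and gap: "l < m" "\<And>w. w \<bullet> v = 0 \<Longrightarrow> m * (w \<bullet> w) \<le> w \<bullet> (A *v w)"
    and u: "norm u = 1" and d1: "norm (u - v) \<le> 1 / 2"
    and d2: "4 * spectral_norm A * norm (u - v) \<le> m - l"
  shows "pos_semidef (newton_J A u)"
  unfolding pos_semidef_def
proof
  have uu: "u \<bullet> u = 1" and vv: "v \<bullet> v = 1" using u v by (simp_all add: dot_square_norm)
  have P: "(perp_proj u *v x) \<bullet> y = x \<bullet> (perp_proj u *v y)" for x y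
    by (simp add: perp_proj_mult inner_diff_left inner_diff_right inner_commute)
  show "transpose (newton_J A u) = newton_J A u"
    by (rule symmetric_matrixI)
      (simp only: newton_J_mult P inner_diff_left inner_diff_right symmetric_matrix_inner[OF A]
        matrix_vector_mult_diff_distrib matrix_vector_mult_scaleR inner_scaleR_left inner_scaleR_right)
  show "\<forall>x. 0 \<le> x \<bullet> (newton_J A u *v x)"
  proof
    fix x
    define z where "z = perp_proj u *v x"
    have uz: "u \<bullet> z = 0" using uu by (simp add: z_def perp_proj_mult inner_diff_right)
    define c where "c = v \<bullet> z"
    define w where "w = z - c *\<^sub>R v"
    have wv: "w \<bullet> v = 0" using vv by (simp add: w_def c_def inner_diff_left inner_commute[of z v])
    have z: "z = w + c *\<^sub>R v" by (simp add: w_def)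
    have zz: "z \<bullet> z = w \<bullet> w + c\<^sup>2"
      using wv vv by (simp add: z inner_add_left inner_add_right inner_commute power2_eq_square)
    have "(A *v w) \<bullet> v = 0" using wv by (simp add: symmetric_matrix_inner[OF A] v)
    then have zAz: "z \<bullet> (A *v z) = w \<bullet> (A *v w) + l * c\<^sup>2"
      using wv vv by (simp add: z matrix_vector_right_distrib matrix_vector_mult_scaleR v
          inner_add_left inner_add_right inner_commute power2_eq_square)
    \<comment> \<open>Subtracting \<open>u \<bullet> z = 0\<close> makes the closeness of
      \<open>u\<close> and \<open>v\<close> visible in \<open>c\<close>.\<close>
    have "c = (v - u) \<bullet> z" using uz by (simp add: c_def inner_diff_left)
    then have "\<bar>c\<bar> \<le> norm (v - u) * norm z" using Cauchy_Schwarz_ineq2 by blast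
    also have "\<dots> \<le> 1 / 2 * norm z" using d1 by (intro mult_right_mono) (auto simp: norm_minus_commute)
    finally have "\<bar>c\<bar>\<^sup>2 \<le> (1 / 2 * norm z)\<^sup>2" by (intro power_mono) auto
    then have c2: "c\<^sup>2 \<le> (z \<bullet> z) / 4" by (simp add: power_mult_distrib power2_norm_eq_inner power_divide)
    have "rayleigh A v = l" by (simp add: rayleigh_def v vv)
    then have "rayleigh A u \<le> l + (m - l) / 2"
      using rayleigh_diff_le[OF A u v(1)] d2 by (simp add: field_simps)
    then have "rayleigh A u * (z \<bullet> z) \<le> (l + (m - l) / 2) * (z \<bullet> z)" by (intro mult_right_mono) auto
    \<comment> \<open>The Rayleigh quotient stays below the midpoint of \<open>l\<close> and
      \<open>m\<close>, and the component along \<open>v\<close> costs at most a quarter of the gap,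
      so a quarter of the gap is left over.\<close>
    also have "\<dots> \<le> m * (z \<bullet> z) - (m - l) * ((z \<bullet> z) / 4)"
    proof -
      have "0 \<le> (m - l) * (z \<bullet> z)" using gap(1) by simp
      then show ?thesis by (simp add: field_simps)
    qed
    also have "\<dots> \<le> m * (z \<bullet> z) - (m - l) * c\<^sup>2"
      using c2 gap(1) by (intro diff_left_mono mult_left_mono) auto
    also have "\<dots> = m * (w \<bullet> w) + l * c\<^sup>2" by (simp add: zz algebra_simps)
    also have "\<dots> \<le> z \<bullet> (A *v z)" using gap(2)[OF wv] by (simp add: zAz)
    finally show "0 \<le> x \<bullet> (newton_J A u *v x)"
      by (simp add: newton_J_mult z_def inner_diff_right flip: P)
  qed
qed

section \<open>The iterates and the final estimate\<close>

text \<open>Because the correction is orthogonal to \<open>u k\<close>, the sum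
  \<open>u k + s k\<close> has component 1 along \<open>u k\<close>. It is thus nonzero, and the
  normalisation never divides by zero.\<close>

lemma newton_iteration_norm:
  assumes "newton_iteration A u s \<rho>"
  shows "norm (u k) = 1"
proof (induction k)
  case 0
  then show ?case using assms by (simp add: newton_iteration_def)
next
  case (Suc k)
  have orth: "u k \<bullet> s k = 0" and step: "u (Suc k) = (u k + s k) /\<^sub>R norm (u k + s k)"
    using assms by (auto simp: newton_iteration_def inner_commute)
  have "u k \<bullet> (u k + s k) = 1" using Suc orth by (simp add: inner_add_right dot_square_norm)
  then have "u k + s k \<noteq> 0" by auto
  then show ?case by (simp add: step)
qed

theorem lemma3p6:
  fixes A :: "real^'n^'n"
    and lam :: "nat \<Rightarrow> real"
    and v1 :: "real^'n"
    and u s \<rho> :: "nat \<Rightarrow> real^'n"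
    and r :: real
  assumes "pos_def A"
    and "strict_mono_on {1..CARD('n)} lam"
    and "{l. eigenvalue A l} = lam ` {1..CARD('n)}"
    and "norm v1 = 1" and "eigenvector A v1 (lam 1)"
    and "newton_iteration A u s \<rho>"
    and "r < 1"
    and "\<And>k. norm (u (Suc k) - v1) < r * norm (u k - v1)"
  shows "\<exists>\<delta>>0. \<exists>c3. \<forall>k. norm (u k - v1) < \<delta> \<longrightarrow>
           spectral_norm (psd_sqrt (newton_J A (u (Suc k))) - psd_sqrt (newton_J A (u k)))
             \<le> c3 * sqrt (norm (u k - v1))"
proof -
  have A: "transpose A = A" using assms(1) by (simp add: pos_def_def)
  have card: "card {l. eigenvalue A l} = CARD('n)"
    using assms(2,3) by (simp add: card_image strict_mono_on_imp_inj_on)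
  have least: "lam 1 \<le> m" if m: "eigenvalue A m" for m
  proof -
    obtain i where i: "i \<in> {1..CARD('n)}" "m = lam i" using m assms(3) by blast
    show ?thesis
    proof (cases "i = 1")
      case False
      then have "lam 1 < lam i" using i by (intro strict_mono_onD[OF assms(2)]) auto
      then show ?thesis by (simp add: i)
    qed (simp add: i)
  qed
  obtain m where gap: "lam 1 < m" "\<And>w. w \<bullet> v1 = 0 \<Longrightarrow> m * (w \<bullet> w) \<le> w \<bullet> (A *v w)"
    using eigenvalue_gap[OF A card assms(5) least] by metis
  have Av: "A *v v1 = lam 1 *\<^sub>R v1" using assms(5) by (simp add: eigenvector_def)
  define L where "L = spectral_norm A"
  have L0: "0 \<le> L" by (simp add: L_def spectral_norm_nonneg)
  \<comment> \<open>The two entries are the two closeness conditions for positivity of the Newton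
    matrix; \<open>L + 1\<close> keeps the denominator positive.\<close>
  define \<delta> where "\<delta> = min (1 / 2) ((m - lam 1) / (4 * (L + 1)))"
  have unit: "norm (u k) = 1" for k by (rule newton_iteration_norm[OF assms(6)])
  have psd: "pos_semidef (newton_J A (u k))" if "norm (u k - v1) < \<delta>" for k
  proof (rule newton_J_pos_semidef[OF A assms(4) Av gap unit])
    show "norm (u k - v1) \<le> 1 / 2" using that by (simp add: \<delta>_def)
    have "norm (u k - v1) \<le> (m - lam 1) / (4 * (L + 1))" using that by (simp add: \<delta>_def)
    then have "4 * (L + 1) * norm (u k - v1) \<le> m - lam 1" using L0 by (simp add: field_simps)
    then show "4 * spectral_norm A * norm (u k - v1) \<le> m - lam 1"
      unfolding L_def[symmetric] distrib_left distrib_right using norm_ge_zero[of "u k - v1"] by linarith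
  qed
  have \<delta>0: "0 < \<delta>" using gap(1) L0 by (simp add: \<delta>_def)
  show ?thesis
  \<comment> \<open>The constant \<open>20 * L\<close> is the Lipschitz constant
    \<open>10 * L\<close> times the bound \<open>2 * norm (u k - v1)\<close> on the step from
    \<open>u k\<close> to \<open>u (Suc k)\<close>.\<close>
  proof (rule exI[of _ \<delta>], rule conjI[OF \<delta>0], rule exI[of _ "sqrt (20 * L)"], intro allI impI)
    fix k assume k: "norm (u k - v1) < \<delta>"
    \<comment> \<open>Errors that do not grow are used twice: to bound the step length by the
      triangle inequality, and to keep \<open>u (Suc k)\<close> in the ball where the Newton matrix
      is positive semidefinite.\<close>
    have less: "norm (u (Suc k) - v1) \<le> norm (u k - v1)"
      using assms(8)[of k] assms(7) mult_right_mono[of r 1 "norm (u k - v1)"] by simp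
    have "norm (u (Suc k) - u k) \<le> 2 * norm (u k - v1)"
      using less norm_triangle_ineq4[of "u (Suc k) - v1" "u k - v1"] by simp
    then have "10 * L * norm (u (Suc k) - u k) \<le> 10 * L * (2 * norm (u k - v1))"
      using L0 by (intro mult_left_mono) auto
    then have "spectral_norm (newton_J A (u (Suc k)) - newton_J A (u k)) \<le> 20 * L * norm (u k - v1)"
      using newton_J_diff_le[OF A unit[of "Suc k"] unit[of k]] by (simp add: L_def)
    then have "sqrt (spectral_norm (newton_J A (u (Suc k)) - newton_J A (u k)))
        \<le> sqrt (20 * L) * sqrt (norm (u k - v1))"
      by (simp flip: real_sqrt_mult)
    moreover have "pos_semidef (newton_J A (u (Suc k)))" using psd[of "Suc k"] less k by simp
    ultimately show "spectral_norm (psd_sqrt (newton_J A (u (Suc k))) - psd_sqrt (newton_J A (u k)))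
        \<le> sqrt (20 * L) * sqrt (norm (u k - v1))"
      using spectral_norm_psd_sqrt_diff_le psd[OF k] order_trans by blast
  qed
qed

end
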